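(* Let $\mathcal{M}$ be a finitely branching countable Markov decision process with real-valued transition rewards and initial state $s_0$, and consider the objective $\mathit{PP}_{\liminf\ge 0}=\{\rho \mid \liminf_{n\to\infty} r(e_n)\ge 0\}$, where $e_0e_1e_2\dots$ is the sequence of transitions of the run $\rho$. Then for every $\varepsilon>0$ there exists a memoryless deterministic (MD) strategy that is $\varepsilon$-optimal for $\mathit{PP}_{\liminf\ge 0}$ from $s_0$.
   Context: A countable MDP $\mathcal{M}=(S,S_\Box,S_\circ,\to,P,r)$ consists of a countable set $S$ of states partitioned into controlled states $S_\Box$ and random states $S_\circ$, a transition relation ${\to}\subseteq S\times S$ in which every state has at least one successor, a function $P$ assigning to each random state a probability distribution over its successors, and a reward function $r:{\to}\to\mathbb{R}$. It is finitely branching if every state has finitely many successors. A run is an infinite sequence $s_0e_0s_1e_1\dots$ with $e_i=(s_i,s_{i+1})\in{\to}$. A strategy assigns to every finite partial run ending in a controlled state a probability distribution over the successors of that state; an initial state $s_0$ and a strategy $\sigma$ induce a probability measure $\mathcal{P}_{\mathcal{M},s_0,\sigma}$ on runs from $s_0$ (random states move according to $P$). The value of an objective $\varphi$ at $s$ is $\sup_\sigma\mathcal{P}_{\mathcal{M},s,\sigma}(\varphi)$; a strategy $\sigma$ is $\varepsilon$-optimal from $s$ if $\mathcal{P}_{\mathcal{M},s,\sigma}(\varphi)\ge$ value$-\varepsilon$. An MD strategy is one whose choice is a Dirac distribution depending only on the current state. *)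

theory Defs
  imports "HOL-Probability.Probability"
begin

record 's mdp =
  states :: "'s set"
  controlled :: "'s set"
  randomized :: "'s set"
  transitions :: "('s \<times> 's) set"
  trans_pmf :: "'s \<Rightarrow> 's pmf"
  reward :: "'s \<times> 's \<Rightarrow> real"

text \<open>The values of \<open>trans_pmf\<close> outside the random states and of \<open>reward\<close> outside
  the transition relation are unconstrained and play no role.\<close>

locale countable_mdp =
  fixes M :: "'s mdp"
  assumes countable_states: "countable (states M)"
    and states_partition: "controlled M \<union> randomized M = states M"
      "controlled M \<inter> randomized M = {}"
    and transitions_subset: "transitions M \<subseteq> states M \<times> states M"
    and successor_exists: "s \<in> states M \<Longrightarrow> transitions M `` {s} \<noteq> {}"
    and set_trans_pmf: "s \<in> randomized M \<Longrightarrow> set_pmf (trans_pmf M s) \<subseteq> transitions M `` {s}"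

definition finitely_branching :: "'s mdp \<Rightarrow> bool" where
  "finitely_branching M \<longleftrightarrow> (\<forall>s\<in>states M. finite (transitions M `` {s}))"

text \<open>Transitions are determined by their endpoints, so a (partial) run
  \<open>s\<^sub>0 e\<^sub>0 s\<^sub>1 e\<^sub>1 \<dots>\<close> is represented by its sequence of states.\<close>

definition runs :: "'s mdp \<Rightarrow> (nat \<Rightarrow> 's) set" where
  "runs M = {\<rho>. \<forall>n. (\<rho> n, \<rho> (Suc n)) \<in> transitions M}"

definition partial_runs :: "'s mdp \<Rightarrow> 's list set" where
  "partial_runs M =
    {h. h \<noteq> [] \<and> set h \<subseteq> states M \<and> successively (\<lambda>s t. (s, t) \<in> transitions M) h}"

text \<open>A strategy is only constrained, and only ever consulted, on partial runs that end in a
  controlled state.\<close>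

definition strategy :: "'s mdp \<Rightarrow> ('s list \<Rightarrow> 's pmf) \<Rightarrow> bool" where
  "strategy M \<sigma> \<longleftrightarrow>
    (\<forall>h\<in>partial_runs M. last h \<in> controlled M \<longrightarrow> set_pmf (\<sigma> h) \<subseteq> transitions M `` {last h})"

definition MD_strategy :: "'s mdp \<Rightarrow> ('s list \<Rightarrow> 's pmf) \<Rightarrow> bool" where
  "MD_strategy M \<sigma> \<longleftrightarrow> strategy M \<sigma> \<and>
    (\<exists>f. \<forall>h\<in>partial_runs M. last h \<in> controlled M \<longrightarrow> \<sigma> h = return_pmf (f (last h)))"

text \<open>Law of the next state after the history \<open>h\<close>; the empty history yields the initial state.
  Sequences that are not partial runs have probability zero. The value chosen for them merely
  makes this a kernel on all finite sequences of states.\<close>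

definition next_pmf :: "'s mdp \<Rightarrow> 's \<Rightarrow> ('s list \<Rightarrow> 's pmf) \<Rightarrow> 's list \<Rightarrow> 's pmf" where
  "next_pmf M s0 \<sigma> h =
    (if h = [] then return_pmf s0
     else if h \<notin> partial_runs M then return_pmf (last h)
     else if last h \<in> controlled M then \<sigma> h
     else trans_pmf M (last h))"

definition step_kernel ::
  "'s mdp \<Rightarrow> 's \<Rightarrow> ('s list \<Rightarrow> 's pmf) \<Rightarrow> nat \<Rightarrow> (nat \<Rightarrow> 's) \<Rightarrow> 's measure" where
  "step_kernel M s0 \<sigma> n \<omega> =
    restrict_space (measure_pmf (next_pmf M s0 \<sigma> (map \<omega> [0..<n]))) (states M)"

text \<open>The measure on infinite state sequences induced by an initial state and a strategy, by the
  Ionescu-Tulcea theorem; it is concentrated on the runs from \<open>s0\<close>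
  (see \<open>emeasure_run_measure_prefix\<close> and \<open>AE_run_measure\<close> below).\<close>

definition run_measure :: "'s mdp \<Rightarrow> 's \<Rightarrow> ('s list \<Rightarrow> 's pmf) \<Rightarrow> (nat \<Rightarrow> 's) measure" where
  "run_measure M s0 \<sigma> =
    projective_family.lim UNIV
      (Ionescu_Tulcea.CI (step_kernel M s0 \<sigma>) (\<lambda>_. count_space (states M)))
      (\<lambda>_. count_space (states M))"

definition mdp_value :: "'s mdp \<Rightarrow> (nat \<Rightarrow> 's) set \<Rightarrow> 's \<Rightarrow> real" where
  "mdp_value M \<phi> s = (SUP \<sigma>\<in>{\<sigma>. strategy M \<sigma>}. measure (run_measure M s \<sigma>) \<phi>)"

definition eps_optimal ::
  "'s mdp \<Rightarrow> (nat \<Rightarrow> 's) set \<Rightarrow> 's \<Rightarrow> real \<Rightarrow> ('s list \<Rightarrow> 's pmf) \<Rightarrow> bool" where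
  "eps_optimal M \<phi> s \<epsilon> \<sigma> \<longleftrightarrow>
    strategy M \<sigma> \<and> measure (run_measure M s \<sigma>) \<phi> \<ge> mdp_value M \<phi> s - \<epsilon>"

definition PP_liminf_nonneg :: "'s mdp \<Rightarrow> (nat \<Rightarrow> 's) set" where
  "PP_liminf_nonneg M =
    {\<rho> \<in> runs M. liminf (\<lambda>n. ereal (reward M (\<rho> n, \<rho> (Suc n)))) \<ge> 0}"

context countable_mdp
begin

lemma set_next_pmf:
  assumes "strategy M \<sigma>" "s0 \<in> states M" "set h \<subseteq> states M"
  shows "set_pmf (next_pmf M s0 \<sigma> h) \<subseteq> states M"
proof (cases "h \<in> partial_runs M")
  case True
  then have "h \<noteq> []" and "last h \<in> states M"
    by (auto simp: partial_runs_def)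
  then have "set_pmf (next_pmf M s0 \<sigma> h) \<subseteq> transitions M `` {last h}"
    using assms(1) True states_partition set_trans_pmf[of "last h"]
    unfolding next_pmf_def strategy_def by auto
  also have "\<dots> \<subseteq> states M"
    using transitions_subset by blast
  finally show ?thesis .
next
  case False
  then show ?thesis
    using assms(2,3) last_in_set[of h] by (simp add: next_pmf_def subset_eq)
qed

lemma Ionescu_Tulcea_step_kernel:
  assumes "strategy M \<sigma>" "s0 \<in> states M"
  shows "Ionescu_Tulcea (step_kernel M s0 \<sigma>) (\<lambda>_. count_space (states M))"
proof -
  have p: "prob_space (step_kernel M s0 \<sigma> n \<omega>)"
    if "\<omega> \<in> space (PiM {0..<n} (\<lambda>_. count_space (states M)))" for n \<omega>
  proof -
    have "set (map \<omega> [0..<n]) \<subseteq> states M"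
      using that by (auto simp: space_PiM PiE_iff)
    from set_next_pmf[OF assms this]
    have "measure (measure_pmf (next_pmf M s0 \<sigma> (map \<omega> [0..<n]))) (states M) = 1"
      by (simp add: measure_pmf.prob_eq_1 AE_measure_pmf_iff subset_eq)
    then show ?thesis
      unfolding step_kernel_def
      by (intro prob_spaceI)
        (simp add: space_restrict_space emeasure_restrict_space measure_pmf.emeasure_eq_measure)
  qed
  have s: "sets (step_kernel M s0 \<sigma> n \<omega>) = sets (count_space (states M))" for n \<omega>
    by (auto simp: step_kernel_def sets_restrict_space)
  show ?thesis
  proof (rule Ionescu_Tulcea.intro)
    fix n
    show "step_kernel M s0 \<sigma> n \<in> PiM {0..<n} (\<lambda>_. count_space (states M))
        \<rightarrow>\<^sub>M subprob_algebra (count_space (states M))"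
      using p[of _ n] s countable_states
      by (auto simp: count_space_PiM_finite space_subprob_algebra
            intro!: prob_space_imp_subprob_space)
  qed (rule p)
qed

lemma
  assumes "strategy M \<sigma>" "s0 \<in> states M"
  shows sets_run_measure: "sets (run_measure M s0 \<sigma>) = sets (PiM UNIV (\<lambda>_. count_space (states M)))"
    and space_run_measure: "space (run_measure M s0 \<sigma>) = (UNIV \<rightarrow>\<^sub>E states M)"
    and prob_space_run_measure: "prob_space (run_measure M s0 \<sigma>)"
proof -
  interpret IT: Ionescu_Tulcea "step_kernel M s0 \<sigma>" "\<lambda>_. count_space (states M)"
    by (rule Ionescu_Tulcea_step_kernel[OF assms])
  show "sets (run_measure M s0 \<sigma>) = sets (PiM UNIV (\<lambda>_. count_space (states M)))"
    by (simp add: run_measure_def)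
  show "space (run_measure M s0 \<sigma>) = (UNIV \<rightarrow>\<^sub>E states M)"
    by (simp add: run_measure_def space_PiM)
  let ?E = "space (PiM {} (\<lambda>_::nat. count_space (states M)))"
  interpret P: prob_space "IT.CI {}"
    by (rule IT.PF.prob_space_P) auto
  have "emeasure IT.PF.lim (IT.PF.emb UNIV {} ?E) = emeasure (IT.CI {}) ?E"
    by (intro IT.lim) auto
  also have "\<dots> = 1"
    using P.emeasure_space_1 by (simp add: IT.PF.space_P)
  also have "IT.PF.emb UNIV {} ?E = space IT.PF.lim"
    by (auto simp: prod_emb_def space_PiM)
  finally show "prob_space (run_measure M s0 \<sigma>)"
    by (intro prob_spaceI) (simp add: run_measure_def)
qed

lemma emeasure_run_measure_prefix:
  assumes "strategy M \<sigma>" "s0 \<in> states M" and x: "x \<in> {0..<n} \<rightarrow>\<^sub>E states M"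
  shows "emeasure (run_measure M s0 \<sigma>) {\<omega> \<in> UNIV \<rightarrow>\<^sub>E states M. \<forall>i<n. \<omega> i = x i} =
    (\<Prod>i<n. pmf (next_pmf M s0 \<sigma> (map x [0..<i])) (x i))"
proof -
  let ?N = "\<lambda>_::nat. count_space (states M)"
  interpret IT: Ionescu_Tulcea "step_kernel M s0 \<sigma>" ?N
    by (rule Ionescu_Tulcea_step_kernel[OF assms(1,2)])
  have PiM: "PiM {0..<n} ?N = count_space ({0..<n} \<rightarrow>\<^sub>E states M)" for n
    using countable_states by (simp add: count_space_PiM_finite)
  have C: "emeasure (IT.C 0 n (\<lambda>_. undefined)) {x} =
    (\<Prod>i<n. pmf (next_pmf M s0 \<sigma> (map x [0..<i])) (x i))"
    if "x \<in> {0..<n} \<rightarrow>\<^sub>E states M" for x n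
    using that
  proof (induction n arbitrary: x)
    case 0
    then show ?case
      by (simp add: PiM_empty)
  next
    case (Suc n)
    let ?y = "restrict x {0..<n}" and ?p = "pmf (next_pmf M s0 \<sigma> (map x [0..<n])) (x n)"
    have y: "?y \<in> {0..<n} \<rightarrow>\<^sub>E states M"
      using Suc.prems by (auto simp: PiE_iff)
    have xy: "x = fun_upd ?y n (x n)"
      using Suc.prems by (auto simp: fun_eq_iff PiE_iff extensional_def)
    have e: "emeasure (IT.eP n \<omega>) {x} = ennreal ?p * indicator {?y} \<omega>"
      if \<omega>: "\<omega> \<in> {0..<n} \<rightarrow>\<^sub>E states M" for \<omega>
    proof -
      have "emeasure (IT.eP n \<omega>) {x} =
          emeasure (step_kernel M s0 \<sigma> n \<omega>) ((\<lambda>t. fun_upd \<omega> n t) -` {x} \<inter> states M)"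
        using \<omega> Suc.prems by (subst IT.emeasure_eP) (simp_all add: PiM)
      also have "(\<lambda>t. fun_upd \<omega> n t) -` {x} \<inter> states M = (if \<omega> = ?y then {x n} else {})"
      proof -
        have "\<omega> = ?y" if "fun_upd \<omega> n t = x" for t
        proof
          show "\<omega> j = ?y j" for j
            using \<omega> that[symmetric] by (cases "j < n") (auto simp: PiE_iff extensional_def)
        qed
        moreover have "x n \<in> states M"
          using Suc.prems by (auto simp: PiE_iff)
        moreover have "t = x n" if "fun_upd \<omega> n t = x" for t
          using that by (metis fun_upd_same)
        ultimately show ?thesis
          using xy by auto
      qed
      also have "emeasure (step_kernel M s0 \<sigma> n \<omega>) (if \<omega> = ?y then {x n} else {}) =
          ennreal ?p * indicator {?y} \<omega>"
      proof (cases "\<omega> = ?y")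
        case True
        have "x n \<in> states M"
          using Suc.prems by (auto simp: PiE_iff)
        then have "emeasure (step_kernel M s0 \<sigma> n x) {x n} = ennreal ?p"
          by (simp add: step_kernel_def emeasure_restrict_space emeasure_pmf_single)
        moreover have "map \<omega> [0..<n] = map x [0..<n]"
          using True by simp
        then have "step_kernel M s0 \<sigma> n \<omega> = step_kernel M s0 \<sigma> n x"
          by (simp only: step_kernel_def)
        ultimately have "emeasure (step_kernel M s0 \<sigma> n \<omega>) {x n} = ennreal ?p"
          by simp
        with True show ?thesis
          by simp
      qed auto
      finally show ?thesis .
    qed
    have sp: "space (IT.C 0 n (\<lambda>_. undefined)) = {0..<n} \<rightarrow>\<^sub>E states M"
      using IT.space_C[of "\<lambda>_. undefined" 0 n] by (simp add: PiM)
    have se: "sets (IT.C 0 n (\<lambda>_. undefined)) = Pow ({0..<n} \<rightarrow>\<^sub>E states M)"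
      using IT.sets_C[of "\<lambda>_. undefined" 0 n] by (simp add: PiM)
    have "emeasure (IT.C 0 (Suc n) (\<lambda>_. undefined)) {x} =
        (\<integral>\<^sup>+ \<omega>. emeasure (IT.eP n \<omega>) {x} \<partial>IT.C 0 n (\<lambda>_. undefined))"
      unfolding IT.C.simps
    proof (subst emeasure_bind)
      show "space (IT.C 0 n (\<lambda>_. undefined)) \<noteq> {}"
        using y unfolding sp by blast
      show "IT.eP (0 + n) \<in> IT.C 0 n (\<lambda>_. undefined) \<rightarrow>\<^sub>M subprob_algebra (PiM {0..<Suc n} ?N)"
        using IT.measurable_eP[of n] se
        by (subst measurable_cong_sets[where M'="PiM {0..<n} ?N"]) (auto simp: PiM)
      show "{x} \<in> sets (PiM {0..<Suc n} ?N)"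
        using Suc.prems by (simp add: PiM)
    qed simp
    also have "\<dots> = (\<integral>\<^sup>+ \<omega>. ennreal ?p * indicator {?y} \<omega> \<partial>IT.C 0 n (\<lambda>_. undefined))"
      by (intro nn_integral_cong e) (simp add: sp)
    also have "\<dots> = ennreal ?p * emeasure (IT.C 0 n (\<lambda>_. undefined)) {?y}"
      using y by (subst nn_integral_cmult_indicator) (auto simp: se)
    also have "\<dots> = ennreal ?p * (\<Prod>i<n. pmf (next_pmf M s0 \<sigma> (map ?y [0..<i])) (?y i))"
      by (simp only: Suc.IH[OF y])
    also have "(\<Prod>i<n. pmf (next_pmf M s0 \<sigma> (map ?y [0..<i])) (?y i)) =
        (\<Prod>i<n. pmf (next_pmf M s0 \<sigma> (map x [0..<i])) (x i))"
    proof (intro prod.cong refl)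
      fix i assume "i \<in> {..<n}"
      then have "map ?y [0..<i] = map x [0..<i]" "?y i = x i"
        by auto
      then show "pmf (next_pmf M s0 \<sigma> (map ?y [0..<i])) (?y i) =
          pmf (next_pmf M s0 \<sigma> (map x [0..<i])) (x i)"
        by (simp only:)
    qed
    finally show ?case
      by (simp add: ennreal_mult prod_nonneg mult.commute)
  qed
  have "{\<omega> \<in> UNIV \<rightarrow>\<^sub>E states M. \<forall>i<n. \<omega> i = x i} = IT.PF.emb UNIV {0..<n} {x}"
    using x by (auto simp: prod_emb_def space_PiM fun_eq_iff PiE_iff extensional_def)
  also have "emeasure (run_measure M s0 \<sigma>) \<dots> = emeasure (IT.CI {0..<n}) {x}"
    unfolding run_measure_def using x by (intro IT.lim) (auto simp: PiM)
  also have "\<dots> = emeasure (IT.C 0 n (\<lambda>_. undefined)) {x}"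
    using x by (subst IT.emeasure_CI[where n=n], simp, simp add: PiM, subst prod_emb_id) auto
  finally show ?thesis
    using C[OF x] by simp
qed

lemma AE_run_measure:
  assumes "strategy M \<sigma>" "s0 \<in> states M"
  shows "AE \<rho> in run_measure M s0 \<sigma>. \<rho> 0 = s0 \<and> \<rho> \<in> runs M"
proof -
  let ?z = "\<lambda>n x. \<exists>i<n. x i \<notin> set_pmf (next_pmf M s0 \<sigma> (map x [0..<i]))"
  have "AE \<rho> in run_measure M s0 \<sigma>. \<not> (\<forall>i<n. \<rho> i = x i)"
    if x: "x \<in> {0..<n} \<rightarrow>\<^sub>E states M" and z: "?z n x" for n x
  proof -
    let ?A = "{\<omega> \<in> UNIV \<rightarrow>\<^sub>E states M. \<forall>i<n. \<omega> i = x i}"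
    have "?A = prod_emb UNIV (\<lambda>_. count_space (states M)) {0..<n} {x}"
      using x by (auto simp: prod_emb_def space_PiM fun_eq_iff PiE_iff extensional_def)
    also have "\<dots> \<in> sets (PiM UNIV (\<lambda>_. count_space (states M)))"
      using x countable_states by (intro sets_PiM_I_finite measurable_prod_emb) (auto simp: count_space_PiM_finite)
    finally have s: "?A \<in> sets (run_measure M s0 \<sigma>)"
      by (simp only: sets_run_measure[OF assms])
    have "(\<Prod>i<n. pmf (next_pmf M s0 \<sigma> (map x [0..<i])) (x i)) = 0"
      using z by (auto simp: set_pmf_iff)
    then have "emeasure (run_measure M s0 \<sigma>) ?A = 0"
      by (simp only: emeasure_run_measure_prefix[OF assms x] ennreal_0)
    from _ this s show ?thesis
      by (rule AE_I) (simp add: space_run_measure[OF assms])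
  qed
  note null = this
  have "AE \<rho> in run_measure M s0 \<sigma>.
      \<forall>x\<in>{x \<in> {0..<n} \<rightarrow>\<^sub>E states M. ?z n x}. \<not> (\<forall>i<n. \<rho> i = x i)" for n
  proof (rule iffD2[OF AE_ball_countable])
    have "countable ({0..<n} \<rightarrow>\<^sub>E states M)"
      using countable_states by (intro countable_PiE) auto
    then show "countable {x \<in> {0..<n} \<rightarrow>\<^sub>E states M. ?z n x}"
      by (rule countable_subset[rotated]) blast
  qed (use null in blast)
  then have "AE \<rho> in run_measure M s0 \<sigma>.
      \<forall>n. \<forall>x\<in>{x \<in> {0..<n} \<rightarrow>\<^sub>E states M. ?z n x}. \<not> (\<forall>i<n. \<rho> i = x i)"
    unfolding AE_all_countable by blast
  then show ?thesis
    using AE_space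
  proof eventually_elim
    case (elim \<rho>)
    have \<rho>: "\<rho> i \<in> states M" for i
      using elim(2) by (auto simp: space_run_measure[OF assms])
    have next_state: "\<rho> i \<in> set_pmf (next_pmf M s0 \<sigma> (map \<rho> [0..<i]))" for i
    proof (rule ccontr)
      assume nz: "\<rho> i \<notin> set_pmf (next_pmf M s0 \<sigma> (map \<rho> [0..<i]))"
      let ?x = "restrict \<rho> {0..<Suc i}"
      have "map ?x [0..<i] = map \<rho> [0..<i]" "?x i = \<rho> i"
        by auto
      then have "?x i \<notin> set_pmf (next_pmf M s0 \<sigma> (map ?x [0..<i]))"
        using nz by (simp only: not_False_eq_True)
      then have "?z (Suc i) ?x"
        by blast
      moreover have "?x \<in> {0..<Suc i} \<rightarrow>\<^sub>E states M"
        using \<rho> by auto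
      ultimately have "\<not> (\<forall>j<Suc i. \<rho> j = ?x j)"
        using elim(1) by blast
      then show False
        by auto
    qed
    have step: "(\<rho> n, \<rho> (Suc n)) \<in> transitions M"
      if "map \<rho> [0..<Suc n] \<in> partial_runs M" for n
    proof -
      have "\<rho> n \<in> controlled M \<or> \<rho> n \<in> randomized M"
        using \<rho>[of n] states_partition by auto
      then show ?thesis
        using next_state[of "Suc n"] that assms(1) set_trans_pmf[of "\<rho> n"] states_partition(2)
        by (fastforce simp: next_pmf_def strategy_def split: if_splits)
    qed
    have "map \<rho> [0..<Suc n] \<in> partial_runs M" for n
    proof (induction n)
      case 0
      show ?case
        using \<rho> by (simp add: partial_runs_def)
    next
      case (Suc n)
      with step[OF Suc] \<rho> show ?case
        by (auto simp: partial_runs_def successively_append_iff)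
    qed
    with step next_state[of 0] show ?case
      by (auto simp: runs_def next_pmf_def)
  qed
qed

lemma sets_PP_liminf_nonneg:
  assumes "strategy M \<sigma>" "s0 \<in> states M"
  shows "PP_liminf_nonneg M \<in> sets (run_measure M s0 \<sigma>)"
proof -
  let ?P = "PiM UNIV (\<lambda>_::nat. count_space (states M))"
  have pair: "(\<lambda>\<rho>. (\<rho> n, \<rho> (Suc n))) \<in> ?P \<rightarrow>\<^sub>M count_space (states M \<times> states M)" for n
  proof -
    have "(\<lambda>\<rho>. (\<rho> n, \<rho> (Suc n))) \<in> ?P \<rightarrow>\<^sub>M (count_space (states M) \<Otimes>\<^sub>M count_space (states M))"
      by measurable
    then show ?thesis
      using countable_states by (simp add: pair_measure_countable)
  qed
  have [measurable]: "(\<lambda>\<rho>. ereal (reward M (\<rho> n, \<rho> (Suc n)))) \<in> borel_measurable ?P" for n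
    by (rule measurable_compose[OF pair]) simp
  have [measurable]: "Measurable.pred ?P (\<lambda>\<rho>. (\<rho> n, \<rho> (Suc n)) \<in> transitions M)" for n
    by (rule measurable_compose[OF pair]) simp
  have "\<rho> n \<in> states M" if "\<rho> \<in> runs M" for \<rho> n
    using that transitions_subset by (auto simp: runs_def)
  then have "PP_liminf_nonneg M =
      {\<rho> \<in> space ?P. (\<forall>n. (\<rho> n, \<rho> (Suc n)) \<in> transitions M) \<and>
        liminf (\<lambda>n. ereal (reward M (\<rho> n, \<rho> (Suc n)))) \<ge> 0}"
    by (auto simp: PP_liminf_nonneg_def runs_def space_PiM)
  also have "\<dots> \<in> sets ?P"
    by measurable
  finally show ?thesis
    by (simp add: sets_run_measure[OF assms])
qed

end

end

theory Submission
  imports Defs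
begin

text \<open>Assign to each transition a cost that depends only on its reward: the sum of weights
  \<open>\<delta>\<^sub>i > 0\<close> over all \<open>i\<close> such that the reward is below \<open>-1/(i+1)\<close>. A run of finite total cost sees
  rewards below \<open>-1/(i+1)\<close> only finitely often, for every \<open>i\<close>, so it satisfies the objective.
  Conversely, given a nearly optimal strategy \<open>\<sigma>\<close>, choose \<open>n\<^sub>i\<close> such that, up to a small probability, the
  winning runs see no reward below \<open>-1/(i+1)\<close> from time \<open>n\<^sub>i\<close> on; if \<open>\<delta>\<^sub>i n\<^sub>i\<close> is small and summable,
  the total cost of these runs is small. Hence in the game where the player pays the costs
  but may quit at any time for a price of 1, \<open>\<sigma>\<close> shows that the value is at most about the losing
  probability of \<open>\<sigma>\<close>. As costs are nonnegative and branching is finite, this game has an optimal MD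
  strategy; it quits with probability at most the value, and has finite cost otherwise.\<close>

subsection \<open>Functions of finite prefixes of runs\<close>

definition determined_by_prefix :: "nat \<Rightarrow> ((nat \<Rightarrow> 's) \<Rightarrow> 'b) \<Rightarrow> bool" where
  "determined_by_prefix n g \<longleftrightarrow> (\<forall>\<rho> \<rho>'. (\<forall>i<n. \<rho> i = \<rho>' i) \<longrightarrow> g \<rho> = g \<rho>')"

lemma determined_by_prefixD:
  assumes "determined_by_prefix n g" "\<And>i. i < n \<Longrightarrow> \<rho> i = \<rho>' i"
  shows "g \<rho> = g \<rho>'"
  using assms unfolding determined_by_prefix_def by blast

lemma determined_by_prefix_nth_map:
  assumes "determined_by_prefix n g"
  shows "g (nth (map \<rho> [0..<n])) = g \<rho>"
  by (rule determined_by_prefixD[OF assms]) simp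

lemma map_upt_eq_iff: "map \<rho> [0..<n] = xs \<longleftrightarrow> length xs = n \<and> (\<forall>i<n. \<rho> i = xs ! i)"
  by (auto simp: list_eq_iff_nth_eq)

text \<open>Law of the first \<open>n\<close> states as a \<open>pmf\<close>. Integrals over it
  unfold through \<open>bind_pmf\<close> without measurability conditions, unlike integrals over
  \<open>run_measure\<close>.\<close>

primrec history_pmf :: "'s mdp \<Rightarrow> 's \<Rightarrow> ('s list \<Rightarrow> 's pmf) \<Rightarrow> nat \<Rightarrow> 's list pmf" where
  "history_pmf M s0 \<sigma> 0 = return_pmf []"
| "history_pmf M s0 \<sigma> (Suc n) =
    bind_pmf (history_pmf M s0 \<sigma> n) (\<lambda>h. map_pmf (\<lambda>t. h @ [t]) (next_pmf M s0 \<sigma> h))"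

text \<open>A nonempty list splits uniquely into its last entry and the rest, so a single history
  contributes at each stage. The product is the one in \<open>emeasure_run_measure_prefix\<close>,
  which makes the two laws comparable list by list.\<close>

lemma emeasure_history_pmf:
  "emeasure (history_pmf M s0 \<sigma> n) {map x [0..<n]} =
    (\<Prod>i<n. pmf (next_pmf M s0 \<sigma> (map x [0..<i])) (x i))"
proof (induction n)
  case 0
  show ?case by simp
next
  case (Suc n)
  let ?h = "map x [0..<n]"
  have "emeasure (map_pmf (\<lambda>t. h @ [t]) (next_pmf M s0 \<sigma> h)) {?h @ [x n]} =
      ennreal (pmf (next_pmf M s0 \<sigma> ?h) (x n)) * indicator {?h} h" for h
  proof -
    have "(\<lambda>t. h @ [t]) -` {?h @ [x n]} = (if h = ?h then {x n} else {})"
      by auto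
    then show ?thesis
      unfolding emeasure_map_pmf by (simp add: emeasure_pmf_single)
  qed
  then have "emeasure (history_pmf M s0 \<sigma> (Suc n)) {map x [0..<Suc n]} =
      ennreal (pmf (next_pmf M s0 \<sigma> ?h) (x n)) * emeasure (history_pmf M s0 \<sigma> n) {?h}"
    by (simp add: nn_integral_cmult)
  then show ?case
    by (simp add: Suc.IH ennreal_mult prod_nonneg mult.commute)
qed

context countable_mdp
begin

text \<open>The target is countable, so preimages of single lists suffice, and each of these is a
  finite intersection of coordinate events.\<close>

lemma measurable_prefix:
  assumes "strategy M \<sigma>" "s0 \<in> states M"
  shows "(\<lambda>\<rho>. map \<rho> [0..<n]) \<in> run_measure M s0 \<sigma> \<rightarrow>\<^sub>M count_space (lists (states M))"
proof (subst measurable_count_space_eq_countable)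
  show "countable (lists (states M))"
    using countable_states by (rule countable_lists)
  have "(\<lambda>\<rho>. map \<rho> [0..<n]) -` {xs} \<inter> (UNIV \<rightarrow>\<^sub>E states M) \<in>
      sets (PiM UNIV (\<lambda>_. count_space (states M)))" for xs
  proof (cases "length xs = n")
    case True
    have "(\<lambda>\<rho>. map \<rho> [0..<n]) -` {xs} \<inter> (UNIV \<rightarrow>\<^sub>E states M) =
        {\<rho> \<in> space (PiM UNIV (\<lambda>_. count_space (states M))). \<forall>i\<in>{..<n}. \<rho> i = xs ! i}"
      using True by (simp add: space_PiM vimage_def Int_def map_upt_eq_iff conj_commute Ball_def)
    also have "\<dots> \<in> sets (PiM UNIV (\<lambda>_. count_space (states M)))"
    proof (rule sets.sets_Collect_finite_All)
      fix i
      have "(\<lambda>\<rho>. \<rho> i) -` ({xs ! i} \<inter> states M) \<inter> space (PiM UNIV (\<lambda>_::nat. count_space (states M)))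
          \<in> sets (PiM UNIV (\<lambda>_. count_space (states M)))"
        by (rule measurable_sets[OF measurable_component_singleton]) auto
      also have "(\<lambda>\<rho>. \<rho> i) -` ({xs ! i} \<inter> states M) \<inter> space (PiM UNIV (\<lambda>_::nat. count_space (states M))) =
          {\<rho> \<in> space (PiM UNIV (\<lambda>_. count_space (states M))). \<rho> i = xs ! i}"
        by (auto simp: space_PiM)
      finally show "{\<rho> \<in> space (PiM UNIV (\<lambda>_::nat. count_space (states M))). \<rho> i = xs ! i}
          \<in> sets (PiM UNIV (\<lambda>_. count_space (states M)))" .
    qed simp
    finally show ?thesis .
  next
    case False
    then have "(\<lambda>\<rho>. map \<rho> [0..<n]) -` {xs} = {}"
      by auto
    then show ?thesis
      by simp
  qed
  then show "(\<lambda>\<rho>. map \<rho> [0..<n]) \<in> space (run_measure M s0 \<sigma>) \<rightarrow> lists (states M) \<and>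
    (\<forall>a\<in>lists (states M). (\<lambda>\<rho>. map \<rho> [0..<n]) -` {a} \<inter> space (run_measure M s0 \<sigma>)
      \<in> sets (run_measure M s0 \<sigma>))"
    using assms by (auto simp: PiE_iff space_run_measure sets_run_measure)
qed

text \<open>\<open>g\<close> factors through the list of the first \<open>n\<close> states, which
  lives in a discrete space. The function \<open>nth\<close> of that list agrees with \<rho> below
  \<open>n\<close>, and \<open>g\<close> looks no further.\<close>

lemma measurable_determined_by_prefix:
  assumes "strategy M \<sigma>" "s0 \<in> states M" "determined_by_prefix n g"
  shows "g \<in> run_measure M s0 \<sigma> \<rightarrow>\<^sub>M count_space UNIV"
proof -
  have "(\<lambda>\<rho>. g (nth (map \<rho> [0..<n]))) \<in> run_measure M s0 \<sigma> \<rightarrow>\<^sub>M count_space UNIV"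
    by (rule measurable_compose[OF measurable_prefix[OF assms(1,2)]]) simp
  then show ?thesis
    by (simp add: determined_by_prefix_nth_map[OF assms(3)])
qed

lemma borel_measurable_determined_by_prefix:
  fixes g :: "(nat \<Rightarrow> 's) \<Rightarrow> 'b::topological_space"
  assumes "strategy M \<sigma>" "s0 \<in> states M" "determined_by_prefix n g"
  shows "g \<in> borel_measurable (run_measure M s0 \<sigma>)"
  using measurable_compose[OF measurable_determined_by_prefix[OF assms], of "\<lambda>x. x" borel] by simp

text \<open>Both measures are concentrated on the countably many lists of length \<open>n\<close>
  over the states and agree on singletons.\<close>

lemma distr_run_measure_prefix:
  assumes \<sigma>: "strategy M \<sigma>" "s0 \<in> states M"
  shows "distr (run_measure M s0 \<sigma>) (count_space UNIV) (\<lambda>\<rho>. map \<rho> [0..<n]) =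
    measure_pmf (history_pmf M s0 \<sigma> n)"
proof -
  let ?R = "run_measure M s0 \<sigma>" and ?\<Omega> = "{xs \<in> lists (states M). length xs = n}"
  have m: "(\<lambda>\<rho>. map \<rho> [0..<n]) \<in> ?R \<rightarrow>\<^sub>M count_space UNIV"
    by (rule measurable_determined_by_prefix[OF \<sigma>, of n])
      (auto simp: determined_by_prefix_def)
  show ?thesis
  proof (rule measure_eqI_countable_AE[where \<Omega>="?\<Omega>"])
    show "AE x in distr ?R (count_space UNIV) (\<lambda>\<rho>. map \<rho> [0..<n]). x \<in> ?\<Omega>"
      by (subst AE_distr_iff[OF m]) (auto simp: space_run_measure[OF \<sigma>] PiE_iff intro!: AE_I2)
    have "set_pmf (history_pmf M s0 \<sigma> n) \<subseteq> {xs \<in> lists (states M). length xs = n}" for n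
    proof (induction n)
      case (Suc n)
      then show ?case
        using set_next_pmf[OF \<sigma>] by (fastforce simp: lists_eq_set)
    qed simp
    then show "AE x in history_pmf M s0 \<sigma> n. x \<in> ?\<Omega>"
      by (auto simp: AE_measure_pmf_iff)
    show "countable ?\<Omega>"
      using countable_lists[OF countable_states] by (rule countable_subset[rotated]) auto
    fix xs assume xs: "xs \<in> ?\<Omega>"
    let ?x = "restrict (nth xs) {0..<n}"
    have x: "?x \<in> {0..<n} \<rightarrow>\<^sub>E states M" "map ?x [0..<n] = xs"
      using xs by (auto simp: PiE_iff in_lists_conv_set map_upt_eq_iff)
    have "emeasure (distr ?R (count_space UNIV) (\<lambda>\<rho>. map \<rho> [0..<n])) {xs} =
        emeasure ?R {\<omega> \<in> UNIV \<rightarrow>\<^sub>E states M. \<forall>i<n. \<omega> i = ?x i}"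
      using xs by (subst emeasure_distr[OF m], simp)
        (simp add: space_run_measure[OF \<sigma>] vimage_def Int_def map_upt_eq_iff conj_commute)
    also have "\<dots> = emeasure (history_pmf M s0 \<sigma> n) {map ?x [0..<n]}"
      by (simp only: emeasure_run_measure_prefix[OF \<sigma> x(1)] emeasure_history_pmf)
    finally show "emeasure (distr ?R (count_space UNIV) (\<lambda>\<rho>. map \<rho> [0..<n])) {xs} =
        emeasure (history_pmf M s0 \<sigma> n) {xs}"
      by (simp only: x(2))
  qed simp_all
qed

text \<open>Tower property: state \<open>n\<close> is integrated out given the states before it.
  Transported to \<open>history_pmf\<close>, this is the integral over a
  \<open>bind_pmf\<close>.\<close>

lemma nn_integral_run_measure_Suc:
  fixes g :: "(nat \<Rightarrow> 's) \<Rightarrow> ennreal"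
  assumes \<sigma>: "strategy M \<sigma>" "s0 \<in> states M" and g: "determined_by_prefix (Suc n) g"
  shows "(\<integral>\<^sup>+\<rho>. g \<rho> \<partial>run_measure M s0 \<sigma>) =
    (\<integral>\<^sup>+\<rho>. \<integral>\<^sup>+t. g (\<rho>(n := t)) \<partial>next_pmf M s0 \<sigma> (map \<rho> [0..<n]) \<partial>run_measure M s0 \<sigma>)"
proof -
  let ?R = "run_measure M s0 \<sigma>"
  have m: "(\<lambda>\<rho>. map \<rho> [0..<n]) \<in> ?R \<rightarrow>\<^sub>M count_space UNIV" for n
    by (rule measurable_determined_by_prefix[OF \<sigma>, of n])
      (auto simp: determined_by_prefix_def)
  have prefix: "(\<integral>\<^sup>+\<rho>. f (map \<rho> [0..<n]) \<partial>?R) = (\<integral>\<^sup>+h. f h \<partial>history_pmf M s0 \<sigma> n)"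
    for f :: "'s list \<Rightarrow> ennreal" and n
    by (subst distr_run_measure_prefix[OF \<sigma>, symmetric], subst nn_integral_distr[OF m]) auto
  have "(\<integral>\<^sup>+\<rho>. g \<rho> \<partial>?R) = (\<integral>\<^sup>+\<rho>. g (nth (map \<rho> [0..<Suc n])) \<partial>?R)"
    by (simp only: determined_by_prefix_nth_map[OF g])
  also have "\<dots> = (\<integral>\<^sup>+h. g (nth h) \<partial>history_pmf M s0 \<sigma> (Suc n))"
    by (rule prefix)
  also have "\<dots> = (\<integral>\<^sup>+h. \<integral>\<^sup>+t. g (nth (h @ [t])) \<partial>next_pmf M s0 \<sigma> h \<partial>history_pmf M s0 \<sigma> n)"
    by simp
  also have "\<dots> = (\<integral>\<^sup>+\<rho>. \<integral>\<^sup>+t. g (nth (map \<rho> [0..<n] @ [t]))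
      \<partial>next_pmf M s0 \<sigma> (map \<rho> [0..<n]) \<partial>?R)"
    by (rule prefix[symmetric])
  also have "\<dots> = (\<integral>\<^sup>+\<rho>. \<integral>\<^sup>+t. g (\<rho>(n := t)) \<partial>next_pmf M s0 \<sigma> (map \<rho> [0..<n]) \<partial>?R)"
    by (intro nn_integral_cong determined_by_prefixD[OF g]) (auto simp: nth_append)
  finally show ?thesis .
qed

lemma AE_prefix_partial_runs:
  assumes \<sigma>: "strategy M \<sigma>" "s0 \<in> states M"
  shows "AE \<rho> in run_measure M s0 \<sigma>. \<rho> 0 = s0 \<and> (\<forall>n. map \<rho> [0..<Suc n] \<in> partial_runs M)"
proof -
  have "map \<rho> [0..<Suc n] \<in> partial_runs M" if "\<rho> \<in> runs M" for \<rho> n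
  proof (induction n)
    case 0
    show ?case
      using that transitions_subset by (auto simp: partial_runs_def runs_def)
  next
    case (Suc n)
    then show ?case
      using that transitions_subset
      by (auto simp: partial_runs_def runs_def successively_append_iff)
  qed
  then show ?thesis
    by (intro eventually_mono[OF AE_run_measure[OF \<sigma>]]) blast
qed

lemma nn_integral_run_measure_initial:
  fixes g :: "(nat \<Rightarrow> 's) \<Rightarrow> ennreal"
  assumes \<sigma>: "strategy M \<sigma>" "s0 \<in> states M" and g: "determined_by_prefix (Suc 0) g"
  shows "(\<integral>\<^sup>+\<rho>. g \<rho> \<partial>run_measure M s0 \<sigma>) = g (\<lambda>_. s0)"
proof -
  interpret prob_space "run_measure M s0 \<sigma>"
    by (rule prob_space_run_measure[OF \<sigma>])
  have "(\<integral>\<^sup>+\<rho>. g \<rho> \<partial>run_measure M s0 \<sigma>) = (\<integral>\<^sup>+\<rho>. g (\<lambda>_. s0) \<partial>run_measure M s0 \<sigma>)"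
    by (intro nn_integral_cong_AE eventually_mono[OF AE_prefix_partial_runs[OF \<sigma>]])
      (auto intro: determined_by_prefixD[OF g])
  then show ?thesis
    by (simp add: emeasure_space_1)
qed

section \<open>Supermartingales and submartingales along runs\<close>

text \<open>The one-step inequality suffices on partial runs because almost every prefix is one. The
  constant sequence merely represents the initial state, since \<open>Y 0\<close> depends on the
  first state only.\<close>

lemma supermartingale_run_measure:
  fixes Y :: "nat \<Rightarrow> (nat \<Rightarrow> 's) \<Rightarrow> ennreal"
  assumes \<sigma>: "strategy M \<sigma>" "s0 \<in> states M"
    and Y: "\<And>n. determined_by_prefix (Suc n) (Y n)"
    and step: "\<And>n \<rho>. map \<rho> [0..<Suc n] \<in> partial_runs M \<Longrightarrow>
      (\<integral>\<^sup>+t. Y (Suc n) (\<rho>(Suc n := t)) \<partial>next_pmf M s0 \<sigma> (map \<rho> [0..<Suc n])) \<le> Y n \<rho>"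
  shows "(\<integral>\<^sup>+\<rho>. Y n \<rho> \<partial>run_measure M s0 \<sigma>) \<le> Y 0 (\<lambda>_. s0)"
proof (induction n)
  case 0
  show ?case
    using nn_integral_run_measure_initial[OF \<sigma>, of "Y 0"] Y[of 0] by simp
next
  case (Suc n)
  have "(\<integral>\<^sup>+\<rho>. Y (Suc n) \<rho> \<partial>run_measure M s0 \<sigma>) \<le> (\<integral>\<^sup>+\<rho>. Y n \<rho> \<partial>run_measure M s0 \<sigma>)"
    unfolding nn_integral_run_measure_Suc[OF \<sigma> Y[of "Suc n"]]
    by (intro nn_integral_mono_AE eventually_mono[OF AE_prefix_partial_runs[OF \<sigma>]] step) blast
  with Suc.IH show ?case
    by (rule order_trans[rotated])
qed

text \<open>The horizon \<open>N\<close> is present because the process to which this is applied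
  carries a value iterate with \<open>N - n\<close> steps left.\<close>

lemma submartingale_run_measure:
  fixes Y :: "nat \<Rightarrow> (nat \<Rightarrow> 's) \<Rightarrow> ennreal"
  assumes \<sigma>: "strategy M \<sigma>" "s0 \<in> states M"
    and Y: "\<And>n. determined_by_prefix (Suc n) (Y n)"
    and step: "\<And>n \<rho>. n < N \<Longrightarrow> map \<rho> [0..<Suc n] \<in> partial_runs M \<Longrightarrow>
      Y n \<rho> \<le> (\<integral>\<^sup>+t. Y (Suc n) (\<rho>(Suc n := t)) \<partial>next_pmf M s0 \<sigma> (map \<rho> [0..<Suc n]))"
    and "n \<le> N"
  shows "Y 0 (\<lambda>_. s0) \<le> (\<integral>\<^sup>+\<rho>. Y n \<rho> \<partial>run_measure M s0 \<sigma>)"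
  using \<open>n \<le> N\<close>
proof (induction n)
  case 0
  show ?case
    using nn_integral_run_measure_initial[OF \<sigma>, of "Y 0"] Y[of 0] by simp
next
  case (Suc n)
  have "(\<integral>\<^sup>+\<rho>. Y n \<rho> \<partial>run_measure M s0 \<sigma>) \<le> (\<integral>\<^sup>+\<rho>. Y (Suc n) \<rho> \<partial>run_measure M s0 \<sigma>)"
    unfolding nn_integral_run_measure_Suc[OF \<sigma> Y[of "Suc n"]]
    using Suc.prems
    by (intro nn_integral_mono_AE eventually_mono[OF AE_prefix_partial_runs[OF \<sigma>]] step) auto
  with Suc show ?case
    by (auto intro: order_trans)
qed

end

subsection \<open>Minimising cost with the option to quit\<close>

text \<open>The quitting game: every transition \<open>e\<close> costs \<open>d e\<close>, and at any state the player may stop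
  by paying 1. Its value \<open>quit_value\<close> is computed by value iteration from 0.\<close>

definition bellman :: "'s mdp \<Rightarrow> ('s \<times> 's \<Rightarrow> ennreal) \<Rightarrow> ('s \<Rightarrow> ennreal) \<Rightarrow> 's \<Rightarrow> ennreal" where
  "bellman M d v s =
    (if s \<in> controlled M then INF t\<in>transitions M `` {s}. d (s, t) + v t
     else \<integral>\<^sup>+t. d (s, t) + v t \<partial>trans_pmf M s)"

text \<open>Value of the game that ends free of charge after \<open>n\<close> transitions; hence the
  iterates increase with \<open>n\<close>.\<close>

primrec quit_value_upto :: "'s mdp \<Rightarrow> ('s \<times> 's \<Rightarrow> ennreal) \<Rightarrow> nat \<Rightarrow> 's \<Rightarrow> ennreal" where
  "quit_value_upto M d 0 = (\<lambda>s. 0)"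
| "quit_value_upto M d (Suc n) = (\<lambda>s. min 1 (bellman M d (quit_value_upto M d n) s))"

definition quit_value :: "'s mdp \<Rightarrow> ('s \<times> 's \<Rightarrow> ennreal) \<Rightarrow> 's \<Rightarrow> ennreal" where
  "quit_value M d s = (SUP n. quit_value_upto M d n s)"

definition path_cost :: "('s \<times> 's \<Rightarrow> ennreal) \<Rightarrow> nat \<Rightarrow> (nat \<Rightarrow> 's) \<Rightarrow> ennreal" where
  "path_cost d n \<rho> = (\<Sum>k<n. d (\<rho> k, \<rho> (Suc k)))"

text \<open>At a state of value 1 only a legal successor is demanded: quitting is optimal there, and
  no successor need satisfy the cost inequality.\<close>

definition greedy :: "'s mdp \<Rightarrow> ('s \<times> 's \<Rightarrow> ennreal) \<Rightarrow> 's \<Rightarrow> 's" where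
  "greedy M d s = (SOME t. t \<in> transitions M `` {s} \<and>
    (quit_value M d s < 1 \<longrightarrow> d (s, t) + quit_value M d t \<le> quit_value M d s))"

definition greedy_strategy :: "'s mdp \<Rightarrow> ('s \<times> 's \<Rightarrow> ennreal) \<Rightarrow> 's list \<Rightarrow> 's pmf" where
  "greedy_strategy M d h = return_pmf (greedy M d (last h))"

section \<open>Value iteration and its limit\<close>

lemma bellman_mono: "v \<le> w \<Longrightarrow> bellman M d v s \<le> bellman M d w s"
  by (auto simp: bellman_def le_fun_def intro!: INF_mono' nn_integral_mono add_left_mono)

lemma incseq_quit_value_upto: "incseq (quit_value_upto M d)"
proof (rule incseq_SucI)
  show "quit_value_upto M d n \<le> quit_value_upto M d (Suc n)" for n
  proof (induction n)
    case (Suc n)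
    then show ?case
      using bellman_mono[OF Suc] by (auto simp: le_fun_def min_le_iff_disj)
  qed (simp add: le_fun_def)
qed

lemma quit_value_upto_le_1: "quit_value_upto M d n s \<le> 1"
  by (cases n) auto

lemma quit_value_le_1: "quit_value M d s \<le> 1"
  unfolding quit_value_def by (intro SUP_least quit_value_upto_le_1)

lemma quit_value_upto_le: "quit_value_upto M d n s \<le> quit_value M d s"
  unfolding quit_value_def by (intro SUP_upper) simp

text \<open>The next iterate is also below 1, so its minimum with the quitting price is attained by
  continuing.\<close>

lemma bellman_quit_value_upto_le:
  assumes "quit_value M d s < 1"
  shows "bellman M d (quit_value_upto M d n) s \<le> quit_value M d s"
proof -
  have "min 1 (bellman M d (quit_value_upto M d n) s) \<le> quit_value M d s"
    using quit_value_upto_le[of M d "Suc n" s] by simp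
  then show ?thesis
    using assms by (auto simp: min_def split: if_splits)
qed

text \<open>The only use of finite branching: infima over finitely many successors commute with the
  increasing limit of the value iterates.\<close>

lemma quit_value_controlled:
  assumes s: "s \<in> controlled M" and lt: "quit_value M d s < 1"
    and fin: "finite (transitions M `` {s})" and ne: "transitions M `` {s} \<noteq> {}"
  shows "\<exists>t\<in>transitions M `` {s}. d (s, t) + quit_value M d t \<le> quit_value M d s"
proof -
  let ?T = "transitions M `` {s}" and ?V = "quit_value_upto M d"
  have "\<exists>t\<in>?T. d (s, t) + ?V n t \<le> quit_value M d s" for n
  proof -
    let ?I = "(\<lambda>t. d (s, t) + ?V n t) ` ?T"
    have I: "finite ?I" "?I \<noteq> {}"
      using fin ne by auto
    then have "Inf ?I \<in> ?I"
      using Min_in[OF I] by (simp only: cInf_eq_Min[OF I])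
    then show ?thesis
      using bellman_quit_value_upto_le[OF lt, of n] s by (auto simp: bellman_def)
  qed
  then obtain t where t: "\<And>n. t n \<in> ?T" "\<And>n. d (s, t n) + ?V n (t n) \<le> quit_value M d s"
    by metis
  \<comment> \<open>The minimisers \<open>t n\<close> for the various horizons take finitely many
    values, so one of them recurs infinitely often; monotonicity of the iterates then carries its
    inequality to every horizon.\<close>
  have "finite (range t)"
    using t(1) by (intro finite_subset[OF _ fin]) auto
  then obtain n0 where inf: "infinite {n \<in> UNIV. t n = t n0}"
    using pigeonhole_infinite[of UNIV t] by auto
  have "d (s, t n0) + ?V n (t n0) \<le> quit_value M d s" for n
  proof -
    obtain m where m: "n \<le> m" "t m = t n0"
      using inf unfolding infinite_nat_iff_unbounded_le by auto
    then have "?V n (t n0) \<le> ?V m (t n0)"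
      using incseq_quit_value_upto[of M d] by (auto simp: incseq_def le_fun_def)
    then have "d (s, t n0) + ?V n (t n0) \<le> d (s, t m) + ?V m (t m)"
      using m by (auto intro: add_left_mono)
    with t(2)[of m] show ?thesis
      by (rule order_trans[rotated])
  qed
  then have "(SUP n. d (s, t n0) + ?V n (t n0)) \<le> quit_value M d s"
    by (intro SUP_least)
  then have "d (s, t n0) + quit_value M d (t n0) \<le> quit_value M d s"
    by (simp add: quit_value_def ennreal_SUP_add_right)
  then show ?thesis
    using t(1) by (rule bexI)
qed

text \<open>Monotone convergence exchanges the expectation with the increasing limit of the
  iterates.\<close>

lemma quit_value_random:
  assumes s: "s \<notin> controlled M" and lt: "quit_value M d s < 1"
  shows "(\<integral>\<^sup>+t. d (s, t) + quit_value M d t \<partial>trans_pmf M s) \<le> quit_value M d s"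
proof -
  let ?V = "quit_value_upto M d"
  have "(\<integral>\<^sup>+t. d (s, t) + quit_value M d t \<partial>trans_pmf M s) =
      (\<integral>\<^sup>+t. (SUP n. d (s, t) + ?V n t) \<partial>trans_pmf M s)"
    by (simp add: quit_value_def ennreal_SUP_add_right)
  also have "\<dots> = (SUP n. \<integral>\<^sup>+t. d (s, t) + ?V n t \<partial>trans_pmf M s)"
    using incseq_quit_value_upto[of M d]
    by (intro nn_integral_monotone_convergence_SUP)
      (auto simp: incseq_def le_fun_def intro!: add_left_mono)
  also have "\<dots> \<le> quit_value M d s"
    using bellman_quit_value_upto_le[OF lt] s by (intro SUP_least) (simp add: bellman_def)
  finally show ?thesis .
qed

lemma path_cost_fun_upd [simp]:
  "path_cost d (Suc n) (\<rho>(Suc n := t)) = path_cost d n \<rho> + d (\<rho> n, t)"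
  by (auto simp: path_cost_def intro!: sum.cong)

section \<open>Arbitrary strategies in the quitting game\<close>

context countable_mdp
begin

lemma next_pmf_partial_run:
  "h \<in> partial_runs M \<Longrightarrow>
    next_pmf M s0 \<sigma> h = (if last h \<in> controlled M then \<sigma> h else trans_pmf M (last h))"
  by (auto simp: next_pmf_def partial_runs_def)

text \<open>A randomised choice averages over successors, each of which costs at least the infimum;
  at random states equality holds.\<close>

lemma bellman_le_next_pmf:
  assumes "strategy M \<sigma>" "h \<in> partial_runs M"
  shows "bellman M d v (last h) \<le> (\<integral>\<^sup>+t. d (last h, t) + v t \<partial>next_pmf M s0 \<sigma> h)"
proof (cases "last h \<in> controlled M")
  case True
  then have "set_pmf (\<sigma> h) \<subseteq> transitions M `` {last h}"
    using assms by (auto simp: strategy_def)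
  then have "(\<integral>\<^sup>+t. (INF t\<in>transitions M `` {last h}. d (last h, t) + v t) \<partial>\<sigma> h) \<le>
      (\<integral>\<^sup>+t. d (last h, t) + v t \<partial>\<sigma> h)"
    by (intro nn_integral_mono_AE) (auto simp: AE_measure_pmf_iff intro!: INF_lower)
  then show ?thesis
    using True assms(2) by (simp add: next_pmf_partial_run bellman_def)
next
  case False
  then show ?thesis
    using assms(2) by (simp add: next_pmf_partial_run bellman_def)
qed

text \<open>Following \<open>\<sigma>\<close> and quitting as soon as the accumulated cost exceeds \<open>\<eta>\<close> is one way
  to play the quitting game.\<close>

lemma quit_value_upto_le_strategy:
  assumes \<sigma>: "strategy M \<sigma>" "s0 \<in> states M" and d: "\<And>e. d e \<le> \<eta>"
  shows "quit_value_upto M d N s0 \<le>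
    (1 + \<eta> + \<eta>) * emeasure (run_measure M s0 \<sigma>) {\<rho> \<in> space (run_measure M s0 \<sigma>). \<eta> < path_cost d N \<rho>} + \<eta>"
proof -
  let ?R = "run_measure M s0 \<sigma>" and ?V = "quit_value_upto M d"
  interpret prob_space ?R
    by (rule prob_space_run_measure[OF \<sigma>])
  \<comment> \<open>Once the cost passes \<eta>, the process is frozen at
    \<open>1 + \<eta> + \<eta>\<close>: cost at most \<eta> before the crossing, at most \<eta> for
    the crossing transition, and at most 1 for the value.\<close>
  define Y where "Y = (\<lambda>n \<rho>. if \<eta> < path_cost d n \<rho> then 1 + \<eta> + \<eta>
    else path_cost d n \<rho> + ?V (N - n) (\<rho> n))"
  have cost: "determined_by_prefix (Suc n) (path_cost d n)" for n
    by (auto simp: determined_by_prefix_def path_cost_def intro!: sum.cong)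
  have m [measurable]: "path_cost d n \<in> borel_measurable ?R" for n
    by (rule borel_measurable_determined_by_prefix[OF \<sigma> cost])
  have "Y 0 (\<lambda>_. s0) \<le> (\<integral>\<^sup>+\<rho>. Y N \<rho> \<partial>?R)"
  proof (rule submartingale_run_measure[OF \<sigma> _ _ order_refl])
    show "determined_by_prefix (Suc n) (Y n)" for n
      unfolding determined_by_prefix_def
    proof (intro allI impI)
      fix \<rho> \<rho>' :: "nat \<Rightarrow> 's" assume eq: "\<forall>i<Suc n. \<rho> i = \<rho>' i"
      then have "path_cost d n \<rho> = path_cost d n \<rho>'"
        using determined_by_prefixD[OF cost] by blast
      with eq show "Y n \<rho> = Y n \<rho>'"
        by (simp add: Y_def)
    qed
  next
    fix n \<rho> assume n: "n < N" and h: "map \<rho> [0..<Suc n] \<in> partial_runs M"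
    let ?p = "next_pmf M s0 \<sigma> (map \<rho> [0..<Suc n])"
    show "Y n \<rho> \<le> (\<integral>\<^sup>+t. Y (Suc n) (\<rho>(Suc n := t)) \<partial>?p)"
    proof (cases "\<eta> < path_cost d n \<rho>")
      case True
      then have "\<eta> < path_cost d n \<rho> + e" for e
        by (rule less_le_trans) simp
      with True show ?thesis
        by (simp add: Y_def)
    next
      case False
      \<comment> \<open>Here \<open>N - n\<close> is a successor, and dropping the minimum with 1
        leaves one application of \<open>bellman\<close>.\<close>
      have "?V (N - n) (\<rho> n) \<le> bellman M d (?V (N - Suc n)) (\<rho> n)"
        using n by (cases "N - n") (auto simp: Suc_diff_Suc[symmetric])
      also have "\<dots> \<le> (\<integral>\<^sup>+t. d (\<rho> n, t) + ?V (N - Suc n) t \<partial>?p)"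
        using bellman_le_next_pmf[OF \<sigma>(1) h] by simp
      finally have "Y n \<rho> \<le> path_cost d n \<rho> + (\<integral>\<^sup>+t. d (\<rho> n, t) + ?V (N - Suc n) t \<partial>?p)"
        using False by (auto simp: Y_def intro: add_left_mono)
      also have "\<dots> = (\<integral>\<^sup>+t. path_cost d n \<rho> + (d (\<rho> n, t) + ?V (N - Suc n) t) \<partial>?p)"
        by (subst nn_integral_add) auto
      also have "\<dots> \<le> (\<integral>\<^sup>+t. Y (Suc n) (\<rho>(Suc n := t)) \<partial>?p)"
      proof (intro nn_integral_mono)
        fix t
        \<comment> \<open>This bound serves the case in which the transition crosses \<eta>;
          otherwise both sides of the goal coincide.\<close>
        have "path_cost d n \<rho> + (d (\<rho> n, t) + ?V (N - Suc n) t) \<le> \<eta> + (\<eta> + 1)"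
          using False d quit_value_upto_le_1 by (intro add_mono) auto
        then show "path_cost d n \<rho> + (d (\<rho> n, t) + ?V (N - Suc n) t) \<le> Y (Suc n) (\<rho>(Suc n := t))"
          by (simp add: Y_def ac_simps)
      qed
      finally show ?thesis .
    qed
  qed
  also have "\<dots> \<le> (\<integral>\<^sup>+\<rho>. (1 + \<eta> + \<eta>) * indicator {\<rho> \<in> space ?R. \<eta> < path_cost d N \<rho>} \<rho> + \<eta> \<partial>?R)"
    \<comment> \<open>At time \<open>N\<close> the remaining value is \<open>?V 0 = 0\<close>, so
      \<open>Y N\<close> is at most \<eta> off the crossing event.\<close>
    by (intro nn_integral_mono) (auto simp: Y_def indicator_def)
  also have "\<dots> = (1 + \<eta> + \<eta>) * emeasure ?R {\<rho> \<in> space ?R. \<eta> < path_cost d N \<rho>} + \<eta>"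
    by (subst nn_integral_add) (auto simp: nn_integral_cmult_indicator emeasure_space_1)
  finally show ?thesis
    by (simp add: Y_def path_cost_def)
qed

section \<open>The greedy strategy\<close>

lemma greedy:
  assumes "finitely_branching M" "s \<in> controlled M"
  shows "greedy M d s \<in> transitions M `` {s}"
    and "quit_value M d s < 1 \<Longrightarrow> d (s, greedy M d s) + quit_value M d (greedy M d s) \<le> quit_value M d s"
proof -
  let ?P = "\<lambda>t. t \<in> transitions M `` {s} \<and>
    (quit_value M d s < 1 \<longrightarrow> d (s, t) + quit_value M d t \<le> quit_value M d s)"
  have s: "finite (transitions M `` {s})" "transitions M `` {s} \<noteq> {}"
    using assms states_partition(1) successor_exists by (auto simp: finitely_branching_def)
  have "\<exists>t. ?P t"
    using quit_value_controlled[OF assms(2) _ s, of d] s(2) by blast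
  then have "?P (greedy M d s)"
    unfolding greedy_def by (rule someI_ex)
  then show "greedy M d s \<in> transitions M `` {s}"
    and "quit_value M d s < 1 \<Longrightarrow> d (s, greedy M d s) + quit_value M d (greedy M d s) \<le> quit_value M d s"
    by blast+
qed

lemma MD_greedy_strategy: "finitely_branching M \<Longrightarrow> MD_strategy M (greedy_strategy M d)"
  using greedy(1) by (auto simp: MD_strategy_def strategy_def greedy_strategy_def)

lemma quit_value_greedy_strategy:
  assumes "finitely_branching M" "h \<in> partial_runs M" "quit_value M d (last h) < 1"
  shows "(\<integral>\<^sup>+t. d (last h, t) + quit_value M d t \<partial>next_pmf M s0 (greedy_strategy M d) h) \<le>
    quit_value M d (last h)"
  using assms greedy(2)[OF assms(1)] quit_value_random
  by (auto simp: next_pmf_partial_run greedy_strategy_def nn_integral_return)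

text \<open>Until a state of value 1 is reached, accumulated cost plus \<open>quit_value\<close> is a supermartingale
  under the greedy strategy. So such a state is reached with probability at most the initial value,
  and otherwise the total cost is almost surely finite.\<close>

lemma finite_cost_greedy_strategy:
  fixes d :: "'s \<times> 's \<Rightarrow> ennreal"
  assumes fb: "finitely_branching M" and s0: "s0 \<in> states M"
  defines "R \<equiv> run_measure M s0 (greedy_strategy M d)"
  shows "{\<rho> \<in> space R. (\<Sum>k. d (\<rho> k, \<rho> (Suc k))) < \<top>} \<in> sets R"
    and "1 \<le> emeasure R {\<rho> \<in> space R. (\<Sum>k. d (\<rho> k, \<rho> (Suc k))) < \<top>} + quit_value M d s0"
proof -
  let ?\<sigma> = "greedy_strategy M d" and ?v = "quit_value M d"
  have \<sigma>: "strategy M ?\<sigma>"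
    using MD_greedy_strategy[OF fb] by (simp add: MD_strategy_def)
  interpret prob_space R
    unfolding R_def by (rule prob_space_run_measure[OF \<sigma> s0])
  have pred: "Measurable.pred R g" if "determined_by_prefix n g" for n and g :: "_ \<Rightarrow> bool"
    unfolding R_def by (rule measurable_determined_by_prefix[OF \<sigma> s0 that])
  have bmeas: "g \<in> borel_measurable R" if "determined_by_prefix n g" for n and g :: "_ \<Rightarrow> ennreal"
    unfolding R_def by (rule borel_measurable_determined_by_prefix[OF \<sigma> s0 that])
  have d [measurable]: "(\<lambda>\<rho>. d (\<rho> k, \<rho> (Suc k))) \<in> borel_measurable R" for k
    by (rule bmeas[of "Suc (Suc k)"]) (auto simp: determined_by_prefix_def)
  show fin [measurable]: "{\<rho> \<in> space R. (\<Sum>k. d (\<rho> k, \<rho> (Suc k))) < \<top>} \<in> sets R"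
    by measurable
  \<comment> \<open>As values never exceed 1, being alive means that no state of value 1 was visited
    up to and including time \<open>n\<close>.\<close>
  define alive where "alive = (\<lambda>(n::nat) (\<rho>::nat \<Rightarrow> 's). \<forall>j\<le>n. ?v (\<rho> j) < 1)"
  have alive: "determined_by_prefix (Suc n) (alive n)" for n
    by (auto simp: determined_by_prefix_def alive_def)
  have [measurable]: "Measurable.pred R (alive n)" for n
    by (rule pred[OF alive])
  define C where "C = (\<lambda>n \<rho>. \<Sum>k<n. if alive k \<rho> then d (\<rho> k, \<rho> (Suc k)) else 0)"
  \<comment> \<open>The process stops at the first state of value 1: no further cost is charged, and
    the summand 1 stands for the price of quitting.\<close>
  define Y where "Y = (\<lambda>n \<rho>. C n \<rho> + (if alive n \<rho> then ?v (\<rho> n) else 1))"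
  have [measurable]: "C n \<in> borel_measurable R" for n
    unfolding C_def by measurable
  have alive_upd: "alive k (\<rho>(Suc n := t)) = alive k \<rho>" if "k \<le> n" for k n \<rho> t
    using that by (auto simp: alive_def)
  have EY: "(\<integral>\<^sup>+\<rho>. Y n \<rho> \<partial>R) \<le> ?v s0" for n
  proof -
    have "(\<integral>\<^sup>+\<rho>. Y n \<rho> \<partial>R) \<le> Y 0 (\<lambda>_. s0)"
      unfolding R_def
    proof (rule supermartingale_run_measure[OF \<sigma> s0])
      show "determined_by_prefix (Suc n) (Y n)" for n
        unfolding determined_by_prefix_def
      proof (intro allI impI)
        fix \<rho> \<rho>' :: "nat \<Rightarrow> 's" assume eq: "\<forall>i<Suc n. \<rho> i = \<rho>' i"
        then have "alive k \<rho> = alive k \<rho>'" if "k \<le> n" for k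
          using determined_by_prefixD[OF alive, of k \<rho> \<rho>'] that by simp
        moreover have "C n \<rho> = C n \<rho>'"
          unfolding C_def using eq calculation by (intro sum.cong) auto
        ultimately show "Y n \<rho> = Y n \<rho>'"
          using eq by (simp add: Y_def)
      qed
    next
      fix n \<rho> assume h: "map \<rho> [0..<Suc n] \<in> partial_runs M"
      let ?p = "next_pmf M s0 ?\<sigma> (map \<rho> [0..<Suc n])"
      have C: "C (Suc n) (\<rho>(Suc n := t)) = C n \<rho> + (if alive n \<rho> then d (\<rho> n, t) else 0)" for t
        by (auto simp: C_def alive_upd intro!: sum.cong)
      have A: "alive (Suc n) (\<rho>(Suc n := t)) \<longleftrightarrow> alive n \<rho> \<and> ?v t < 1" for t
        by (auto simp: alive_def le_Suc_eq)
      show "(\<integral>\<^sup>+t. Y (Suc n) (\<rho>(Suc n := t)) \<partial>?p) \<le> Y n \<rho>"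
      proof (cases "alive n \<rho>")
        case True
        have "Y (Suc n) (\<rho>(Suc n := t)) = C n \<rho> + (d (\<rho> n, t) + ?v t)" for t
          using True quit_value_le_1[of M d t] by (auto simp: Y_def C A add.assoc)
        then have "(\<integral>\<^sup>+t. Y (Suc n) (\<rho>(Suc n := t)) \<partial>?p) =
            (\<integral>\<^sup>+t. C n \<rho> + (d (\<rho> n, t) + ?v t) \<partial>?p)"
          by (simp only:)
        also have "\<dots> = C n \<rho> + (\<integral>\<^sup>+t. d (\<rho> n, t) + ?v t \<partial>?p)"
          by (subst nn_integral_add) auto
        also have "\<dots> \<le> C n \<rho> + ?v (\<rho> n)"
          using quit_value_greedy_strategy[OF fb h, of d s0] True
          by (intro add_left_mono) (auto simp: alive_def)
        finally show ?thesis
          using True by (simp add: Y_def)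
      next
        case False
        then show ?thesis
          by (simp add: Y_def C A)
      qed
    qed
    also have "\<dots> = ?v s0"
      using quit_value_le_1[of M d s0] by (auto simp: Y_def C_def alive_def)
    finally show ?thesis .
  qed
  \<comment> \<open>Bounded expectations and monotone convergence make the limit of \<open>C\<close>
    finite almost surely; on runs that stay alive forever this limit is the total cost.\<close>
  have "(\<integral>\<^sup>+\<rho>. C n \<rho> \<partial>R) \<le> 1" for n
    using EY[of n] quit_value_le_1[of M d s0]
    by (intro order_trans[OF nn_integral_mono order_trans[OF EY[of n]]]) (auto simp: Y_def)
  moreover have "incseq C"
    by (auto simp: incseq_def C_def le_fun_def intro!: sum_mono2)
  ultimately have "(\<integral>\<^sup>+\<rho>. (SUP n. C n \<rho>) \<partial>R) \<le> 1"
    by (subst nn_integral_monotone_convergence_SUP) (auto intro: SUP_least)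
  then have "AE \<rho> in R. (SUP n. C n \<rho>) \<noteq> \<infinity>"
    by (intro nn_integral_PInf_AE) (auto simp: top_unique)
  then have AE: "AE \<rho> in R. (\<Sum>k. d (\<rho> k, \<rho> (Suc k))) < \<top> \<or> (\<exists>n. \<not> alive n \<rho>)"
  proof eventually_elim
    case (elim \<rho>)
    show ?case
    proof (cases "\<exists>n. \<not> alive n \<rho>")
      case False
      then have "(\<Sum>k. d (\<rho> k, \<rho> (Suc k))) = (SUP n. C n \<rho>)"
        by (simp add: C_def suminf_eq_SUP)
      with elim show ?thesis
        by (simp only: less_top infinity_ennreal_def not_False_eq_True simp_thms)
    qed simp
  qed
  let ?D = "\<lambda>n. {\<rho> \<in> space R. \<not> alive n \<rho>}"
  have D: "emeasure R (\<Union>n. ?D n) \<le> ?v s0"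
  proof -
    have "emeasure R (?D n) \<le> ?v s0" for n
    proof -
      \<comment> \<open>Markov's inequality in its simplest form: \<open>Y n\<close> is at least 1
        wherever the run is no longer alive.\<close>
      have "emeasure R (?D n) = (\<integral>\<^sup>+\<rho>. indicator (?D n) \<rho> \<partial>R)"
        by simp
      also have "\<dots> \<le> (\<integral>\<^sup>+\<rho>. Y n \<rho> \<partial>R)"
        by (intro nn_integral_mono) (auto simp: Y_def indicator_def)
      finally show ?thesis
        using EY order_trans by blast
    qed
    then have "(SUP n. emeasure R (?D n)) \<le> ?v s0"
      by (rule SUP_least)
    moreover have "incseq ?D"
      by (auto simp: incseq_def alive_def intro: order_trans)
    then have "(SUP n. emeasure R (?D n)) = emeasure R (\<Union>n. ?D n)"
      by (intro SUP_emeasure_incseq) auto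
    ultimately show ?thesis
      by simp
  qed
  let ?F = "{\<rho> \<in> space R. (\<Sum>k. d (\<rho> k, \<rho> (Suc k))) < \<top>}"
  have "1 = emeasure R (?F \<union> (\<Union>n. ?D n))"
    using AE AE_space
    by (intro emeasure_eq_1_AE[symmetric]) (auto elim: eventually_elim2)
  also have "\<dots> \<le> emeasure R ?F + emeasure R (\<Union>n. ?D n)"
    by (intro emeasure_subadditive) auto
  finally show "1 \<le> emeasure R ?F + ?v s0"
    using add_left_mono[OF D] by (rule order_trans)
qed

end

subsection \<open>Costs by reward level\<close>

definition level_cost :: "(nat \<Rightarrow> real) \<Rightarrow> real \<Rightarrow> ennreal" where
  "level_cost \<delta> x = (\<Sum>i. ennreal (\<delta> i) * indicator {x. x < - 1 / Suc i} x)"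

text \<open>Summable costs tend to 0 and so eventually stay below \<open>\<delta> i\<close>, whereas
  every entry below \<open>- 1 / Suc i\<close> costs at least \<open>\<delta> i\<close>.\<close>

lemma liminf_nonneg_if_finite_level_cost:
  assumes \<delta>: "\<And>i. 0 < \<delta> i" and fin: "(\<Sum>k. level_cost \<delta> (x k)) < \<top>"
  shows "0 \<le> liminf (\<lambda>k. ereal (x k))"
  unfolding le_Liminf_iff
proof (intro allI impI)
  fix y :: ereal assume y: "y < 0"
  obtain i where i: "y < ereal (- 1 / Suc i)"
  proof (cases y)
    case (real r)
    then obtain i where "inverse (real (Suc i)) < - r"
      using y reals_Archimedean[of "- r"] by auto
    then have "y < ereal (- 1 / Suc i)"
      using real by (simp add: inverse_eq_divide)
    then show ?thesis
      by (rule that)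
  qed (use y that[of 0] in auto)
  have top: "level_cost \<delta> (x k) < \<top>" for k
    using fin by (rule ennreal_suminf_lessD)
  \<comment> \<open>Passing to real values gives access to the convergence to 0 of the terms of a
    summable series.\<close>
  define g where "g k = enn2real (level_cost \<delta> (x k))" for k
  have g: "level_cost \<delta> (x k) = ennreal (g k)" for k
    using top[of k] by (simp add: g_def)
  have "summable g"
    using fin by (intro summable_suminf_not_top) (simp_all add: g_def top)
  then have "g \<longlonglongrightarrow> 0"
    by (rule summable_LIMSEQ_zero)
  then have "\<forall>\<^sub>F k in sequentially. g k < \<delta> i"
    using \<delta> by (rule order_tendstoD)
  then show "\<forall>\<^sub>F k in sequentially. y < ereal (x k)"
  proof eventually_elim
    case (elim k)
    have "\<not> x k < - 1 / Suc i"
    proof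
      assume "x k < - 1 / Suc i"
      then have "ennreal (\<delta> i) = ennreal (\<delta> i) * indicator {x. x < - 1 / Suc i} (x k)"
        by simp
      also have "\<dots> \<le> level_cost \<delta> (x k)"
        unfolding level_cost_def
        using sum_le_suminf[OF summableI, of "{i}" "\<lambda>i. ennreal (\<delta> i) * indicator {x. x < - 1 / Suc i} (x k)"]
        by (simp del: sum_mult_indicator)
      finally show False
        using ennreal_lessI[OF \<delta> elim] by (simp only: g leD)
    qed
    then have "ereal (- 1 / Suc i) \<le> ereal (x k)"
      by simp
    with i show ?case
      by (rule less_le_trans)
  qed
qed

lemma eventually_above_level_if_liminf_nonneg:
  assumes "0 \<le> liminf (\<lambda>k. ereal (x k))"
  shows "\<exists>n. \<forall>k\<ge>n. \<not> x k < - 1 / Suc i"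
proof -
  have "ereal (- 1 / Suc i) < 0"
    by simp
  then have "\<forall>\<^sub>F k in sequentially. ereal (- 1 / Suc i) < ereal (x k)"
    using assms unfolding le_Liminf_iff by blast
  then show ?thesis
    unfolding eventually_sequentially using less_ereal.simps(1) by (metis less_asym)
qed

text \<open>Level \<open>i\<close> receives the share \<open>\<eta> / 2 ^ Suc i\<close> of a total
  budget \<eta>; the same split is used for costs and for probabilities.\<close>

lemma suminf_geometric_half: "(\<Sum>i. ennreal (\<eta> / 2 ^ Suc i)) = ennreal \<eta>" if "0 \<le> \<eta>"
proof -
  have "(\<lambda>i. \<eta> * (1 / 2) ^ Suc i) sums (\<eta> * 1)"
    using power_half_series by (rule sums_mult)
  then have "(\<lambda>i. \<eta> / 2 ^ Suc i) sums \<eta>"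
    by (simp add: power_one_over field_simps)
  then show ?thesis
    using that by (intro suminf_ennreal_eq) auto
qed

text \<open>Bounds a single transition, and with it the overshoot past \<eta> in
  \<open>quit_value_upto_le_strategy\<close>.\<close>

lemma level_cost_le:
  assumes "0 \<le> \<eta>" "\<And>i. \<delta> i \<le> \<eta> / 2 ^ Suc i"
  shows "level_cost \<delta> x \<le> ennreal \<eta>"
proof -
  have "level_cost \<delta> x \<le> (\<Sum>i. ennreal (\<eta> / 2 ^ Suc i))"
    unfolding level_cost_def using assms(2)
    by (intro suminf_le) (auto simp: indicator_def intro!: ennreal_leI)
  then show ?thesis
    by (simp only: suminf_geometric_half[OF assms(1)])
qed

text \<open>After exchanging the sums, level \<open>i\<close> is charged at most \<open>n i\<close>
  times, hence contributes at most \<open>\<delta> i * n i\<close>.\<close>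

lemma sum_level_cost_le:
  fixes x \<delta> :: "nat \<Rightarrow> real" and n :: "nat \<Rightarrow> nat"
  assumes "0 \<le> \<eta>" "\<And>i. 0 \<le> \<delta> i" "\<And>i. \<delta> i * n i \<le> \<eta> / 2 ^ Suc i"
    and x: "\<And>i k. n i \<le> k \<Longrightarrow> \<not> x k < - 1 / Suc i"
  shows "(\<Sum>k<N. level_cost \<delta> (x k)) \<le> ennreal \<eta>"
proof -
  have "(\<Sum>k<N. level_cost \<delta> (x k)) =
      (\<Sum>i. \<Sum>k<N. ennreal (\<delta> i) * indicator {x. x < - 1 / Suc i} (x k))"
    unfolding level_cost_def by (rule suminf_sum[symmetric]) simp
  also have "\<dots> \<le> (\<Sum>i. ennreal (\<eta> / 2 ^ Suc i))"
  proof (intro suminf_le)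
    fix i
    have "(\<Sum>k<N. ennreal (\<delta> i) * indicator {x. x < - 1 / Suc i} (x k)) \<le>
        (\<Sum>k<N. if k \<in> {..<n i} then ennreal (\<delta> i) else 0)"
      using x[of i] by (intro sum_mono) (auto simp: indicator_def)
    also have "\<dots> = (\<Sum>k\<in>{..<N} \<inter> {..<n i}. ennreal (\<delta> i))"
      by (rule sum.inter_restrict[symmetric]) simp
    also have "\<dots> \<le> (\<Sum>k<n i. ennreal (\<delta> i))"
      by (rule sum_mono2) auto
    also have "\<dots> = ennreal (\<delta> i * n i)"
      using assms(2) by (simp add: ennreal_mult ennreal_of_nat_eq_real_of_nat mult.commute)
    also have "\<dots> \<le> ennreal (\<eta> / 2 ^ Suc i)"
      by (intro ennreal_leI assms(3))
    finally show "(\<Sum>k<N. ennreal (\<delta> i) * indicator {x. x < - 1 / Suc i} (x k)) \<le>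
        ennreal (\<eta> / 2 ^ Suc i)" .
  qed simp_all
  finally show ?thesis
    by (simp only: suminf_geometric_half[OF assms(1)])
qed

section \<open>Choice of the weights and near-optimality of the greedy strategy\<close>

context countable_mdp
begin

lemma exists_level_cost:
  assumes \<sigma>: "strategy M \<sigma>" "s0 \<in> states M" and \<eta>: "0 < \<eta>"
  defines "R \<equiv> run_measure M s0 \<sigma>"
  obtains \<delta> where "\<And>i. 0 < \<delta> i" "\<And>x. level_cost \<delta> x \<le> ennreal \<eta>"
    "\<And>N. emeasure R {\<rho> \<in> space R. ennreal \<eta> < path_cost (\<lambda>e. level_cost \<delta> (reward M e)) N \<rho>} \<le>
      ennreal (1 - measure R (PP_liminf_nonneg M) + \<eta>)"
proof -
  let ?PP = "PP_liminf_nonneg M" and ?r = "\<lambda>\<rho> k. reward M (\<rho> k, \<rho> (Suc k))"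
  interpret prob_space R
    unfolding R_def by (rule prob_space_run_measure[OF \<sigma>])
  have PP [measurable]: "?PP \<in> sets R"
    unfolding R_def by (rule sets_PP_liminf_nonneg[OF \<sigma>])
  have [measurable]: "(\<lambda>\<rho>. ?r \<rho> k) \<in> borel_measurable R" for k
    unfolding R_def
    by (rule borel_measurable_determined_by_prefix[OF \<sigma>, of "Suc (Suc k)"])
      (auto simp: determined_by_prefix_def)
  \<comment> \<open>Winning runs that still violate level \<open>i\<close> at time \<open>n\<close>
    or later. For fixed \<open>i\<close> these events decrease to the empty set, so their
    probabilities tend to 0.\<close>
  define A where "A i n = {\<rho> \<in> space R. \<rho> \<in> ?PP \<and> (\<exists>k\<ge>n. ?r \<rho> k < - 1 / Suc i)}" for i n
  have A [measurable]: "A i n \<in> sets R" for i n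
    unfolding A_def by measurable
  have "\<exists>n. measure R (A i n) \<le> \<eta> / 2 ^ Suc i" for i
  proof -
    have "decseq (A i)"
      by (auto simp: decseq_def A_def) (meson order_trans)
    moreover have "(\<Inter>n. A i n) = {}"
    proof -
      have "\<exists>n. \<forall>k\<ge>n. \<not> ?r \<rho> k < - 1 / Suc i" if "\<rho> \<in> ?PP" for \<rho>
        using that by (intro eventually_above_level_if_liminf_nonneg) (simp add: PP_liminf_nonneg_def)
      then show ?thesis
        by (fastforce simp: A_def)
    qed
    moreover have "range (A i) \<subseteq> sets R"
      by auto
    ultimately have "(\<lambda>n. measure R (A i n)) \<longlonglongrightarrow> 0"
      using finite_Lim_measure_decseq[of "A i"] by simp
    then have "\<forall>\<^sub>F n in sequentially. measure R (A i n) < \<eta> / 2 ^ Suc i"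
      using \<eta> by (intro order_tendstoD) auto
    then obtain n where "measure R (A i n) < \<eta> / 2 ^ Suc i"
      by (rule eventually_happens'[OF sequentially_bot, elim_format]) blast
    then show ?thesis
      by (intro exI[of _ n] less_imp_le)
  qed
  then obtain n where n: "\<And>i. measure R (A i (n i)) \<le> \<eta> / 2 ^ Suc i"
    by metis
  \<comment> \<open>Dividing by \<open>Suc (n i)\<close> avoids a zero denominator and keeps both
    \<open>\<delta> i\<close> and \<open>\<delta> i * n i\<close> within the share of level
    \<open>i\<close>.\<close>
  define \<delta> where "\<delta> i = \<eta> / 2 ^ Suc i / Suc (n i)" for i
  have \<delta>_pos: "0 < \<delta> i" for i
    using \<eta> by (simp add: \<delta>_def)
  have \<delta>_Suc: "\<delta> i * Suc (n i) = \<eta> / 2 ^ Suc i" for i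
    by (simp add: \<delta>_def del: of_nat_Suc)
  have \<delta>_n: "\<delta> i * n i \<le> \<eta> / 2 ^ Suc i" for i
    unfolding \<delta>_Suc[symmetric] using \<delta>_pos[of i] by (intro mult_left_mono) auto
  have \<delta>_le: "\<delta> i \<le> \<eta> / 2 ^ Suc i" for i
    unfolding \<delta>_Suc[symmetric] using \<delta>_pos[of i] by simp
  let ?A = "\<Union>i. A i (n i)"
  have "emeasure R ?A \<le> (\<Sum>i. emeasure R (A i (n i)))"
    by (intro emeasure_subadditive_countably) auto
  also have "\<dots> \<le> (\<Sum>i. ennreal (\<eta> / 2 ^ Suc i))"
    using n by (intro suminf_le) (auto simp: emeasure_eq_measure intro!: ennreal_leI)
  finally have "measure R ?A \<le> \<eta>"
    using \<eta> by (simp only: suminf_geometric_half[OF less_imp_le[OF \<eta>]]) (simp add: emeasure_eq_measure)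
  have "emeasure R {\<rho> \<in> space R. ennreal \<eta> < path_cost (\<lambda>e. level_cost \<delta> (reward M e)) N \<rho>} \<le>
      ennreal (1 - measure R ?PP + \<eta>)" for N
  proof -
    \<comment> \<open>A winning run outside every \<open>A i (n i)\<close> respects all the
      thresholds \<open>n i\<close>, so its cost never exceeds \<eta>.\<close>
    have "{\<rho> \<in> space R. ennreal \<eta> < path_cost (\<lambda>e. level_cost \<delta> (reward M e)) N \<rho>} \<subseteq>
        (space R - ?PP) \<union> ?A"
    proof (intro subsetI, rule ccontr)
      fix \<rho> assume \<rho>: "\<rho> \<in> {\<rho> \<in> space R. ennreal \<eta> < path_cost (\<lambda>e. level_cost \<delta> (reward M e)) N \<rho>}"
        "\<rho> \<notin> (space R - ?PP) \<union> ?A"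
      then have "\<not> ?r \<rho> k < - 1 / Suc i" if "n i \<le> k" for i k
        using that by (auto simp: A_def)
      then have "path_cost (\<lambda>e. level_cost \<delta> (reward M e)) N \<rho> \<le> ennreal \<eta>"
        unfolding path_cost_def using \<eta> \<delta>_pos \<delta>_n
        by (intro sum_level_cost_le[where n=n]) (auto intro: less_imp_le)
      with \<rho>(1) show False
        by (simp add: leD)
    qed
    then have "emeasure R {\<rho> \<in> space R. ennreal \<eta> < path_cost (\<lambda>e. level_cost \<delta> (reward M e)) N \<rho>} \<le>
        emeasure R ((space R - ?PP) \<union> ?A)"
      by (intro emeasure_mono) auto
    also have "\<dots> = ennreal (measure R ((space R - ?PP) \<union> ?A))"
      by (rule emeasure_eq_measure)
    also have "measure R ((space R - ?PP) \<union> ?A) \<le> measure R (space R - ?PP) + measure R ?A"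
      by (intro measure_Un_le) auto
    also have "\<dots> \<le> 1 - measure R ?PP + \<eta>"
      using \<open>measure R ?A \<le> \<eta>\<close> by (simp add: prob_compl)
    finally show ?thesis
      by (simp add: ennreal_leI)
  qed
  with \<delta>_pos level_cost_le[OF less_imp_le[OF \<eta>] \<delta>_le] show ?thesis
    by (rule that)
qed

lemma MD_strategy_near_strategy:
  assumes fb: "finitely_branching M" and \<sigma>: "strategy M \<sigma>" "s0 \<in> states M"
    and \<eta>: "0 < \<eta>" "\<eta> \<le> 1"
  obtains \<tau> where "MD_strategy M \<tau>"
    "measure (run_measure M s0 \<sigma>) (PP_liminf_nonneg M) - 6 * \<eta> \<le>
      measure (run_measure M s0 \<tau>) (PP_liminf_nonneg M)"
proof -
  let ?PP = "PP_liminf_nonneg M"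
  define p where "p = measure (run_measure M s0 \<sigma>) ?PP"
  interpret \<sigma>: prob_space "run_measure M s0 \<sigma>"
    by (rule prob_space_run_measure[OF \<sigma>])
  have p: "0 \<le> p" "p \<le> 1"
    by (simp_all add: p_def)
  obtain \<delta> where \<delta>: "\<And>i. 0 < \<delta> i" "\<And>x. level_cost \<delta> x \<le> ennreal \<eta>"
    and le: "\<And>N. emeasure (run_measure M s0 \<sigma>) {\<rho> \<in> space (run_measure M s0 \<sigma>).
        ennreal \<eta> < path_cost (\<lambda>e. level_cost \<delta> (reward M e)) N \<rho>} \<le> ennreal (1 - p + \<eta>)"
    unfolding p_def by (rule exists_level_cost[OF \<sigma> \<eta>(1)]) blast
  define d where "d e = level_cost \<delta> (reward M e)" for e
  define \<tau> where "\<tau> = greedy_strategy M d"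
  define R where "R = run_measure M s0 \<tau>"
  have MD: "MD_strategy M \<tau>"
    unfolding \<tau>_def by (rule MD_greedy_strategy[OF fb])
  then have \<tau>: "strategy M \<tau>"
    by (simp add: MD_strategy_def)
  interpret R: prob_space R
    unfolding R_def by (rule prob_space_run_measure[OF \<tau> \<sigma>(2)])
  have PP: "?PP \<in> sets R"
    unfolding R_def by (rule sets_PP_liminf_nonneg[OF \<tau> \<sigma>(2)])
  have "quit_value_upto M d N s0 \<le> ennreal (1 - p + 6 * \<eta>)" for N
  proof -
    have "quit_value_upto M d N s0 \<le> (1 + ennreal \<eta> + ennreal \<eta>) * emeasure (run_measure M s0 \<sigma>)
        {\<rho> \<in> space (run_measure M s0 \<sigma>). ennreal \<eta> < path_cost d N \<rho>} + ennreal \<eta>"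
      using \<delta>(2) by (intro quit_value_upto_le_strategy[OF \<sigma>]) (simp add: d_def)
    also have "\<dots> \<le> (1 + ennreal \<eta> + ennreal \<eta>) * ennreal (1 - p + \<eta>) + ennreal \<eta>"
      using le[of N] by (intro add_right_mono mult_left_mono) (simp_all add: d_def[abs_def])
    also have "\<dots> = ennreal ((1 + \<eta> + \<eta>) * (1 - p + \<eta>) + \<eta>)"
      using p \<eta> by (simp add: ennreal_plus[symmetric] ennreal_mult[symmetric] flip: ennreal_1 del: ennreal_plus)
    also have "\<dots> \<le> ennreal (1 - p + 6 * \<eta>)"
    proof (intro ennreal_leI)
      \<comment> \<open>Origin of the 6: the product expands to \<open>1 - p + \<eta>\<close> plus
        \<open>2 * \<eta> * (1 - p)\<close> and \<open>2 * \<eta> * \<eta>\<close>, each at most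
        \<open>2 * \<eta>\<close>, and a last \<eta> is added.\<close>
      have "\<eta> * (1 - p) \<le> \<eta>" "\<eta> * \<eta> \<le> \<eta>"
        using p \<eta> by (simp_all add: mult_left_le)
      then show "(1 + \<eta> + \<eta>) * (1 - p + \<eta>) + \<eta> \<le> 1 - p + 6 * \<eta>"
        by (simp add: algebra_simps)
    qed
    finally show ?thesis .
  qed
  then have v: "quit_value M d s0 \<le> ennreal (1 - p + 6 * \<eta>)"
    unfolding quit_value_def by (rule SUP_least)
  let ?F = "{\<rho> \<in> space R. (\<Sum>k. d (\<rho> k, \<rho> (Suc k))) < \<top>}"
  have F: "?F \<in> sets R" "1 \<le> emeasure R ?F + quit_value M d s0"
    using finite_cost_greedy_strategy[OF fb \<sigma>(2), of d] by (simp_all add: R_def \<tau>_def)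
  \<comment> \<open>Finite cost gives only the liminf condition; membership in \<open>runs M\<close>
    holds almost surely, hence the comparison up to null sets.\<close>
  have "emeasure R ?F \<le> emeasure R ?PP"
  proof (rule emeasure_mono_AE[OF _ PP])
    show "AE \<rho> in R. \<rho> \<in> ?F \<longrightarrow> \<rho> \<in> ?PP"
      using AE_run_measure[OF \<tau> \<sigma>(2), folded R_def]
    proof eventually_elim
      case (elim \<rho>)
      then show ?case
        using liminf_nonneg_if_finite_level_cost[of \<delta> "\<lambda>k. reward M (\<rho> k, \<rho> (Suc k))"] \<delta>(1)
        by (simp add: PP_liminf_nonneg_def d_def)
    qed
  qed
  then have "1 \<le> emeasure R ?PP + ennreal (1 - p + 6 * \<eta>)"
    using F(2) v by (meson add_mono order_trans)
  then have "ennreal 1 \<le> ennreal (measure R ?PP + (1 - p + 6 * \<eta>))"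
    using p \<eta> by (simp add: R.emeasure_eq_measure)
  then have "1 \<le> measure R ?PP + (1 - p + 6 * \<eta>)"
    using p \<eta> by (subst (asm) ennreal_le_iff) auto
  then show ?thesis
    using that[OF MD] by (simp add: p_def R_def)
qed

end

theorem theorem3p5:
  fixes M :: "'s mdp" and s0 :: 's and \<epsilon> :: real
  assumes "countable_mdp M"
    and "finitely_branching M"
    and "s0 \<in> states M"
    and "\<epsilon> > 0"
  shows "\<exists>\<sigma>. MD_strategy M \<sigma> \<and> eps_optimal M (PP_liminf_nonneg M) s0 \<epsilon> \<sigma>"
proof -
  interpret countable_mdp M
    by fact
  let ?P = "\<lambda>\<sigma>. measure (run_measure M s0 \<sigma>) (PP_liminf_nonneg M)"
  \<comment> \<open>Of the seven parts, one pays for choosing \<sigma> close to the supremum and six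
    for passing from \<sigma> to \<tau>.\<close>
  define \<eta> where "\<eta> = min 1 (\<epsilon> / 7)"
  have \<eta>: "0 < \<eta>" "\<eta> \<le> 1" "7 * \<eta> \<le> \<epsilon>"
    using assms(4) by (auto simp: \<eta>_def)
  \<comment> \<open>A greedy strategy, for whatever cost function, witnesses that the supremum
    ranges over a nonempty set.\<close>
  have "{\<sigma>. strategy M \<sigma>} \<noteq> {}"
    using MD_greedy_strategy[OF assms(2)] by (auto simp: MD_strategy_def)
  moreover have "mdp_value M (PP_liminf_nonneg M) s0 - \<eta> < (SUP \<sigma>\<in>{\<sigma>. strategy M \<sigma>}. ?P \<sigma>)"
    using \<eta>(1) by (simp add: mdp_value_def)
  ultimately obtain \<sigma> where \<sigma>: "strategy M \<sigma>"
    "mdp_value M (PP_liminf_nonneg M) s0 - \<eta> < ?P \<sigma>"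
    using less_cSupD[of "?P ` {\<sigma>. strategy M \<sigma>}"] by auto
  obtain \<tau> where "MD_strategy M \<tau>" "?P \<sigma> - 6 * \<eta> \<le> ?P \<tau>"
    by (rule MD_strategy_near_strategy[OF assms(2) \<sigma>(1) assms(3) \<eta>(1,2)])
  with \<sigma>(2) \<eta>(3) show ?thesis
    by (auto simp: eps_optimal_def MD_strategy_def intro!: exI[of _ \<tau>])
qed

end
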